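(* Let $G$ and $H$ be two connected graphs of order $n_1\ge 2$ and $n_2\ge 2$, respectively. Then $$3 \le \dim_l(G\boxtimes H)\le n_1\cdot \dim_l(H) + n_2\cdot \dim_l(G) - \dim_l(G)\cdot \dim_l(H).$$
   Context: All graphs are finite, simple and connected; $d_G(x,y)$ denotes the shortest-path distance in $G$. A vertex $s$ distinguishes vertices $x,y$ if $d_G(s,x)\ne d_G(s,y)$. A set $S\subseteq V(G)$ is a local metric generator for $G$ if every two adjacent vertices of $G$ are distinguished by some vertex of $S$; the local metric dimension $\dim_l(G)$ is the minimum cardinality of a local metric generator. The strong product $G\boxtimes H$ has vertex set $V(G)\times V(H)$, with $(a,b)$ and $(c,d)$ adjacent iff ($a=c$ and $bd\in E(H)$) or ($b=d$ and $ac\in E(G)$) or ($ac\in E(G)$ and $bd\in E(H)$). *)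

theory Defs
  imports "Graph_Theory.Graph_Theory"
begin

text \<open>Finite simple graphs are the symmetric loop-free pair digraphs of locale
  \<^locale>\<open>pair_graph\<close>: an edge is represented by its two opposite arcs.\<close>

text \<open>With unit weights the cost of a walk is its length, so \<open>\<mu>\<close> (the infimum of the
  costs of all walks from \<open>u\<close> to \<open>v\<close>) is the shortest-path distance; it is finite when the
  graph is connected. The defining equation of \<open>\<mu>\<close> is available only for well-formed graphs.\<close>

definition graph_dist :: "'a pair_pre_digraph \<Rightarrow> 'a \<Rightarrow> 'a \<Rightarrow> ereal" where
  "graph_dist G u v = wf_digraph.\<mu> (with_proj G) (\<lambda>_. 1) u v"

definition distinguishes :: "'a pair_pre_digraph \<Rightarrow> 'a \<Rightarrow> 'a \<Rightarrow> 'a \<Rightarrow> bool" where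
  "distinguishes G s x y \<longleftrightarrow> graph_dist G s x \<noteq> graph_dist G s y"

definition local_metric_generator :: "'a pair_pre_digraph \<Rightarrow> 'a set \<Rightarrow> bool" where
  "local_metric_generator G S \<longleftrightarrow>
     S \<subseteq> pverts G \<and> (\<forall>(x, y) \<in> parcs G. \<exists>s\<in>S. distinguishes G s x y)"

text \<open>The minimum below is attained: in a \<^locale>\<open>pair_graph\<close>, \<open>pverts G\<close> is a local metric
  generator, and every generator is finite.\<close>

definition local_metric_dim :: "'a pair_pre_digraph \<Rightarrow> nat" where
  "local_metric_dim G = (LEAST k. \<exists>S. local_metric_generator G S \<and> card S = k)"

text \<open>The conditions \<open>a \<in> pverts G\<close> and \<open>b \<in> pverts H\<close> keep the arcs inside
  the vertex set.\<close>

definition strong_product ::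
    "'a pair_pre_digraph \<Rightarrow> 'b pair_pre_digraph \<Rightarrow> ('a \<times> 'b) pair_pre_digraph"
    (infixl \<open>\<boxtimes>\<close> 70) where
  "G \<boxtimes> H =
     \<lparr> pverts = pverts G \<times> pverts H,
       parcs = {((a, b), (c, d)) | a b c d.
           (a = c \<and> a \<in> pverts G \<and> (b, d) \<in> parcs H) \<or>
           (b = d \<and> b \<in> pverts H \<and> (a, c) \<in> parcs G) \<or>
           ((a, c) \<in> parcs G \<and> (b, d) \<in> parcs H)} \<rparr>"

lemma pair_graph_strong_product:
  assumes "pair_graph G" "pair_graph H"
  shows "pair_graph (G \<boxtimes> H)"
proof -
  interpret G: pair_graph G by fact
  interpret H: pair_graph H by fact
  have sub: "parcs (G \<boxtimes> H) \<subseteq> pverts (G \<boxtimes> H) \<times> pverts (G \<boxtimes> H)"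
    by (auto simp: strong_product_def dest: G.wellformed' H.wellformed')
  have fin: "finite (pverts (G \<boxtimes> H))"
    by (simp add: strong_product_def G.pair_finite_verts H.pair_finite_verts)
  show ?thesis
  proof
    show "finite (parcs (G \<boxtimes> H))"
      using sub fin by (meson finite_SigmaI finite_subset)
    show "symmetric (with_proj (G \<boxtimes> H))"
      by (auto simp: symmetric_def sym_def strong_product_def
          intro: G.arcs_symmetric H.arcs_symmetric)
    show "fst e \<noteq> snd e" if "e \<in> parcs (G \<boxtimes> H)" for e
      using that by (auto simp: strong_product_def dest: G.no_loops' H.no_loops')
  qed (use sub fin in auto)
qed

end

theory Submission
  imports Defs
begin

text \<open>A walk of length at most \<open>n\<close> is the same as \<open>n\<close> steps of the graph with a loop added at
  every vertex. With loops the strong product becomes the direct product of relations, so its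
  distance is the maximum of the distances in the factors.

  Upper bound: if \<open>S\<^sub>1\<close> and \<open>S\<^sub>2\<close> are minimum local metric generators of \<open>G\<close> and \<open>H\<close>, then
  \<open>V(G) \<times> S\<^sub>2 \<union> S\<^sub>1 \<times> V(H)\<close> is one of \<open>G \<boxtimes> H\<close>: if \<open>s\<close> distinguishes the adjacent vertices
  \<open>b, d\<close> of \<open>H\<close> and is closer to \<open>b\<close>, then \<open>(a, s)\<close> distinguishes \<open>(a, b)\<close> from \<open>(c, d)\<close>.

  Lower bound: every landmark \<open>s\<close> lies in a clique of four vertices, whose other three vertices
  are all at distance 1 from \<open>s\<close>. The distances from a second landmark to these three vertices
  differ pairwise by at most 1, so they cannot be pairwise distinct.\<close>

section \<open>Walks and powers of the arc relation with loops\<close>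

definition lazy_arcs :: "'a pair_pre_digraph \<Rightarrow> 'a rel" where
  "lazy_arcs G = Id_on (pverts G) \<union> parcs G"

text \<open>A natural-number form of the distance, so that the arguments below need no
  \<open>ereal\<close> arithmetic; \<open>graph_dist_eq_hop_dist\<close> links the two for connected
  graphs.\<close>

definition hop_dist :: "'a pair_pre_digraph \<Rightarrow> 'a \<Rightarrow> 'a \<Rightarrow> nat" where
  "hop_dist G u v = (LEAST n. (u, v) \<in> lazy_arcs G ^^ n)"

context pair_wf_digraph
begin

lemma awalk_imp_lazy_relpow:
  "awalk u p v \<Longrightarrow> (u, v) \<in> lazy_arcs G ^^ length p"
proof (induction p arbitrary: u)
  case Nil
  then show ?case by (simp add: awalk_Nil_iff)
next
  case (Cons e p)
  then have "(u, snd e) \<in> lazy_arcs G" "(snd e, v) \<in> lazy_arcs G ^^ length p"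
    by (cases e; auto simp: awalk_Cons_iff lazy_arcs_def)+
  then show ?case by (metis length_Cons relpow_Suc_I2)
qed

text \<open>Dropping the loop steps leaves a genuine walk, possibly shorter than \<open>n\<close>.
  The zeroth power is the identity on the whole type, so \<open>u\<close> has to be assumed a
  vertex.\<close>

lemma lazy_relpow_imp_awalk:
  assumes "(u, v) \<in> lazy_arcs G ^^ n" "u \<in> pverts G"
  shows "\<exists>p. awalk u p v \<and> length p \<le> n"
  using assms
proof (induction n arbitrary: u)
  case 0
  then have "awalk u [] v" by (simp add: awalk_Nil_iff)
  then show ?case by fastforce
next
  case (Suc n)
  from relpow_Suc_D2[OF Suc.prems(1)] obtain w
    where w: "(u, w) \<in> lazy_arcs G" "(w, v) \<in> lazy_arcs G ^^ n" by blast
  then have "w \<in> pverts G"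
    by (auto simp: lazy_arcs_def dest: wellformed')
  with Suc.IH w obtain p where p: "awalk w p v" "length p \<le> n" by blast
  consider "u = w" | "(u, w) \<in> parcs G"
    using w(1) by (auto simp: lazy_arcs_def)
  then show ?case
  proof cases
    case 1
    with p show ?thesis using le_SucI by blast
  next
    case 2
    with p have "awalk u ((u, w) # p) v"
      using Suc.prems(2) by (simp add: awalk_Cons_iff)
    with p(2) show ?thesis by (metis Suc_le_mono length_Cons)
  qed
qed

text \<open>Waiting at the loop of the end vertex \<open>v\<close> pads the walk.\<close>

lemma lazy_relpow_mono:
  assumes "(u, v) \<in> lazy_arcs G ^^ m" "v \<in> pverts G" "m \<le> n"
  shows "(u, v) \<in> lazy_arcs G ^^ n"
  using assms(3)
proof (induction n rule: dec_induct)
  case (step n)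
  have "(v, v) \<in> lazy_arcs G" using assms(2) by (simp add: lazy_arcs_def Id_on_iff)
  with step.IH show ?case by (rule relpow_Suc_I)
qed (rule assms(1))

end

section \<open>Distance in a connected graph\<close>

locale connected_pair_graph = pair_graph +
  assumes all_reachable: "u \<in> pverts G \<Longrightarrow> v \<in> pverts G \<Longrightarrow> u \<rightarrow>\<^sup>*\<^bsub>with_proj G\<^esub> v"
begin

lemma lazy_relpow_exists:
  assumes "u \<in> pverts G" "v \<in> pverts G"
  shows "\<exists>n. (u, v) \<in> lazy_arcs G ^^ n"
  using all_reachable[OF assms] awalk_imp_lazy_relpow by (auto simp: reachable_awalk)

lemma hop_dist_le_iff:
  assumes "u \<in> pverts G" "v \<in> pverts G"
  shows "hop_dist G u v \<le> n \<longleftrightarrow> (u, v) \<in> lazy_arcs G ^^ n"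
proof
  assume "hop_dist G u v \<le> n"
  moreover have "(u, v) \<in> lazy_arcs G ^^ hop_dist G u v"
    unfolding hop_dist_def using lazy_relpow_exists[OF assms] by (rule LeastI_ex)
  ultimately show "(u, v) \<in> lazy_arcs G ^^ n"
    using lazy_relpow_mono assms(2) by blast
qed (auto simp: hop_dist_def intro: Least_le)

lemma graph_dist_eq_hop_dist:
  assumes "u \<in> pverts G" "v \<in> pverts G"
  shows "graph_dist G u v = ereal (real (hop_dist G u v))"
proof -
  have cost: "awalk_cost (\<lambda>_. 1) p = real (length p)" for p :: "('a \<times> 'a) list"
    by (induction p) auto
  \<comment> \<open>This walk attains the infimum: \<open>le\<close> below forces its length to be
    exactly \<open>hop_dist G u v\<close>.\<close>
  obtain p where p: "awalk u p v" "length p \<le> hop_dist G u v"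
    using lazy_relpow_imp_awalk assms hop_dist_le_iff by blast
  have le: "hop_dist G u v \<le> length q" if "awalk u q v" for q
    using awalk_imp_lazy_relpow[OF that] hop_dist_le_iff[OF assms] by blast
  show ?thesis
    unfolding graph_dist_def \<mu>_def cost
  proof (rule INF_eqI)
    show "y \<le> ereal (real (hop_dist G u v))"
      if "\<And>q. q \<in> {q. awalk u q v} \<Longrightarrow> y \<le> ereal (real (length q))" for y
      using that[of p] p le[OF p(1)] by simp
  qed (use le in simp)
qed

lemma distinguishes_iff_hop_dist:
  assumes "s \<in> pverts G" "x \<in> pverts G" "y \<in> pverts G"
  shows "distinguishes G s x y \<longleftrightarrow> hop_dist G s x \<noteq> hop_dist G s y"
  using assms by (simp add: distinguishes_def graph_dist_eq_hop_dist)

lemma hop_dist_self: "u \<in> pverts G \<Longrightarrow> hop_dist G u u = 0"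
  using hop_dist_le_iff[of u u 0] by simp

lemma hop_dist_adjacent:
  assumes "(u, v) \<in> parcs G"
  shows "hop_dist G u v = 1"
proof -
  have uv: "u \<in> pverts G" "v \<in> pverts G" "u \<noteq> v"
    using assms by (auto dest: wellformed' no_loops')
  then have "hop_dist G u v \<le> 1" "\<not> hop_dist G u v \<le> 0"
    using assms by (auto simp: hop_dist_le_iff lazy_arcs_def simp del: le_zero_eq)
  then show ?thesis by simp
qed

lemma hop_dist_Lipschitz:
  assumes "s \<in> pverts G" "(x, y) \<in> parcs G"
  shows "hop_dist G s y \<le> Suc (hop_dist G s x)"
proof -
  have xy: "x \<in> pverts G" "y \<in> pverts G" using assms by (auto dest: wellformed')
  have "(s, x) \<in> lazy_arcs G ^^ hop_dist G s x"
    using hop_dist_le_iff assms(1) xy(1) by blast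
  moreover have "(x, y) \<in> lazy_arcs G" using assms(2) by (simp add: lazy_arcs_def)
  ultimately have "(s, y) \<in> lazy_arcs G ^^ Suc (hop_dist G s x)" by (rule relpow_Suc_I)
  then show ?thesis using hop_dist_le_iff assms(1) xy(2) by blast
qed

section \<open>Local metric generators of a connected graph\<close>

lemma local_metric_generator_pverts: "local_metric_generator G (pverts G)"
proof -
  have "distinguishes G x x y" if "(x, y) \<in> parcs G" for x y
    using that wellformed'[OF that]
    by (simp add: distinguishes_iff_hop_dist hop_dist_self hop_dist_adjacent)
  then show ?thesis
    by (auto simp: local_metric_generator_def dest: wellformed')
qed

lemma minimum_local_metric_generator_exists:
  "\<exists>S. local_metric_generator G S \<and> card S = local_metric_dim G"
  unfolding local_metric_dim_def
  by (rule LeastI_ex) (use local_metric_generator_pverts in blast)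

text \<open>A walk from \<open>u\<close> to a second vertex has a first arc, and that arc leaves
  \<open>u\<close>.\<close>

lemma pverts_adjacent_exists:
  assumes "u \<in> pverts G" "card (pverts G) \<ge> 2"
  shows "\<exists>v. (u, v) \<in> parcs G"
proof -
  have "pverts G \<noteq> {u}" using assms(2) by auto
  then obtain w where w: "w \<in> pverts G" "w \<noteq> u" using assms(1) by blast
  obtain p where "awalk u p w"
    using all_reachable[OF assms(1) w(1)] by (auto simp: reachable_awalk)
  then show ?thesis
    using w(2) by (cases p) (auto simp: awalk_Nil_iff awalk_Cons_iff)
qed

lemma card_local_metric_generator_ge_3:
  assumes S: "local_metric_generator G S" and ne: "pverts G \<noteq> {}"
    and K4: "\<And>s. s \<in> pverts G \<Longrightarrow>
      \<exists>x y z. {(s, x), (s, y), (s, z), (x, y), (y, z), (x, z)} \<subseteq> parcs G"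
  shows "3 \<le> card S"
proof (rule ccontr)
  assume small: "\<not> 3 \<le> card S"
  have sub: "S \<subseteq> pverts G" using S by (simp add: local_metric_generator_def)
  then have "finite S" using pair_finite_verts finite_subset by blast
  have distinguished: "\<exists>r\<in>S. distinguishes G r u v" if "(u, v) \<in> parcs G" for u v
    using S that by (auto simp: local_metric_generator_def)
  \<comment> \<open>Some arc exists and must be distinguished, so \<open>S\<close> contains a first
    landmark \<open>s\<close>.\<close>
  obtain v w where "(v, w) \<in> parcs G" using ne K4 by blast
  with distinguished obtain s where s: "s \<in> S" by blast
  with sub have "s \<in> pverts G" by blast
  from K4[OF this] obtain x y z
    where arcs: "(s, x) \<in> parcs G" "(s, y) \<in> parcs G" "(s, z) \<in> parcs G"
      "(x, y) \<in> parcs G" "(y, z) \<in> parcs G" "(x, z) \<in> parcs G"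
    unfolding insert_subset by blast
  have near: "hop_dist G s x = 1" "hop_dist G s y = 1" "hop_dist G s z = 1"
    using arcs by (simp_all add: hop_dist_adjacent)
  have "card (S - {s}) \<le> Suc 0" using small s \<open>finite S\<close> by simp
  then have "\<forall>u\<in>S - {s}. \<forall>v\<in>S - {s}. u = v"
    using \<open>finite S\<close> by (simp add: card_le_Suc0_iff_eq)
  \<comment> \<open>If \<open>S = {s}\<close>, then \<open>t\<close> is arbitrary; membership of
    \<open>t\<close> in \<open>S\<close> is only recovered through \<open>sep\<close>.\<close>
  then obtain t where t: "S \<subseteq> {s, t}" by blast
  \<comment> \<open>The landmark \<open>s\<close> sees \<open>u\<close> and \<open>v\<close> at
    equal distance, so the one separating them can only be \<open>t\<close>.\<close>
  have sep: "t \<in> S \<and> hop_dist G t u \<noteq> hop_dist G t v"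
    if arc: "(u, v) \<in> parcs G" and eq: "hop_dist G s u = hop_dist G s v" for u v
  proof -
    obtain r where r: "r \<in> S" "distinguishes G r u v"
      using distinguished[OF arc] by blast
    have "hop_dist G r u \<noteq> hop_dist G r v"
      using r sub wellformed'[OF arc] by (simp add: distinguishes_iff_hop_dist subset_iff)
    moreover from this have "r = t" using eq r(1) t by blast
    ultimately show ?thesis using r(1) by simp
  qed
  have "t \<in> S" and differ: "hop_dist G t x \<noteq> hop_dist G t y"
      "hop_dist G t y \<noteq> hop_dist G t z" "hop_dist G t x \<noteq> hop_dist G t z"
    using sep[OF arcs(4)] sep[OF arcs(5)] sep[OF arcs(6)] near by simp_all
  then have "t \<in> pverts G" using sub by blast
  then have close: "hop_dist G t w \<le> Suc (hop_dist G t v) \<and> hop_dist G t v \<le> Suc (hop_dist G t w)"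
    if "(v, w) \<in> parcs G" for v w
    using hop_dist_Lipschitz[OF _ that] hop_dist_Lipschitz[OF _ arcs_symmetric[OF that]] by simp
  \<comment> \<open>Among three pairwise distinct natural numbers two differ by at least 2, against
    \<open>close\<close>.\<close>
  show False
    using close[OF arcs(4)] close[OF arcs(5)] close[OF arcs(6)] differ by linarith
qed

end

text \<open>\<open>connected\<close> means strong connectedness of the symmetric closure; the arcs
  are already symmetric, so reachability does not change.\<close>

lemma connected_pair_graphI:
  assumes "pair_graph G" "Digraph_Component.connected (with_proj G)"
  shows "connected_pair_graph G"
proof -
  interpret pair_graph G by fact
  have "strongly_connected (mk_symmetric (with_proj G))"
    using assms(2) by (simp add: connected_def)
  then show ?thesis
    by unfold_locales
      (simp add: strongly_connected_def reachable_mk_symmetric_eq[OF pair_sym_arcs])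
qed

lemma local_metric_dim_le:
  "local_metric_generator G S \<Longrightarrow> local_metric_dim G \<le> card S"
  unfolding local_metric_dim_def by (rule Least_le) blast

section \<open>Distance in the strong product\<close>

lemma lazy_arcs_strong_product:
  "((a, b), (c, d)) \<in> lazy_arcs (G \<boxtimes> H) \<longleftrightarrow> (a, c) \<in> lazy_arcs G \<and> (b, d) \<in> lazy_arcs H"
  by (auto simp: lazy_arcs_def strong_product_def)

text \<open>A loop and the three kinds of product arcs together say that each coordinate
  independently stays or moves. Induction carries this independence over to powers.\<close>

lemma lazy_relpow_strong_product:
  "((a, b), (c, d)) \<in> lazy_arcs (G \<boxtimes> H) ^^ n \<longleftrightarrow>
    (a, c) \<in> lazy_arcs G ^^ n \<and> (b, d) \<in> lazy_arcs H ^^ n"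
proof (induction n arbitrary: c d)
  case (Suc n)
  then show ?case by (auto simp: relcomp_unfold lazy_arcs_strong_product)
qed auto

locale connected_pair_graph_product =
  G: connected_pair_graph G + H: connected_pair_graph H
  for G :: "'a pair_pre_digraph" and H :: "'b pair_pre_digraph"
begin

lemma pverts_strong_product: "pverts (G \<boxtimes> H) = pverts G \<times> pverts H"
  by (simp add: strong_product_def)

sublocale GH: connected_pair_graph "G \<boxtimes> H"
proof -
  interpret P: pair_graph "G \<boxtimes> H"
    by (rule pair_graph_strong_product) (rule G.pair_graph H.pair_graph)+
  show "connected_pair_graph (G \<boxtimes> H)"
  proof
    fix u v assume uv: "u \<in> pverts (G \<boxtimes> H)" "v \<in> pverts (G \<boxtimes> H)"
    obtain a b c d where [simp]: "u = (a, b)" "v = (c, d)" by fastforce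
    have V: "a \<in> pverts G" "c \<in> pverts G" "b \<in> pverts H" "d \<in> pverts H"
      using uv by (auto simp: pverts_strong_product)
    obtain m n where "(a, c) \<in> lazy_arcs G ^^ m" "(b, d) \<in> lazy_arcs H ^^ n"
      using G.lazy_relpow_exists H.lazy_relpow_exists V by meson
    \<comment> \<open>The two walks may differ in length; loops pad the shorter one.\<close>
    then have "(u, v) \<in> lazy_arcs (G \<boxtimes> H) ^^ max m n"
      using G.lazy_relpow_mono H.lazy_relpow_mono V
      by (simp add: lazy_relpow_strong_product)
    from P.lazy_relpow_imp_awalk[OF this uv(1)]
    show "u \<rightarrow>\<^sup>*\<^bsub>with_proj (G \<boxtimes> H)\<^esub> v" by (auto simp: P.reachable_awalk)
  qed
qed

text \<open>Both sides have the same upper bounds \<open>n\<close>, hence are equal.\<close>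

lemma hop_dist_strong_product:
  assumes "a \<in> pverts G" "c \<in> pverts G" "b \<in> pverts H" "d \<in> pverts H"
  shows "hop_dist (G \<boxtimes> H) (a, b) (c, d) = max (hop_dist G a c) (hop_dist H b d)"
proof -
  have "hop_dist (G \<boxtimes> H) (a, b) (c, d) \<le> n \<longleftrightarrow>
      max (hop_dist G a c) (hop_dist H b d) \<le> n" for n
    using assms by (simp add: GH.hop_dist_le_iff G.hop_dist_le_iff H.hop_dist_le_iff
        pverts_strong_product lazy_relpow_strong_product)
  then show ?thesis by (metis le_antisym order_refl)
qed

section \<open>Upper bound: landmarks of the product from landmarks of the factors\<close>

lemma distinguishes_strong_product_snd:
  assumes s: "s \<in> pverts H" "distinguishes H s b d" and bd: "(b, d) \<in> parcs H"
    and ac: "(a, c) \<in> lazy_arcs G"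
  shows "\<exists>g\<in>pverts G. distinguishes (G \<boxtimes> H) (g, s) (a, b) (c, d)"
proof -
  have V: "a \<in> pverts G" "c \<in> pverts G" "b \<in> pverts H" "d \<in> pverts H"
    using ac bd by (auto simp: lazy_arcs_def dest: G.wellformed' H.wellformed')
  have ca: "(c, a) \<in> lazy_arcs G"
    using ac by (auto simp: lazy_arcs_def dest: G.arcs_symmetric)
  have le1: "hop_dist G a c \<le> 1" "hop_dist G c a \<le> 1"
    using ac ca V by (simp_all add: G.hop_dist_le_iff)
  have ne: "hop_dist H s b \<noteq> hop_dist H s d"
    using s V by (simp add: H.distinguishes_iff_hop_dist)
  have iff: "distinguishes (G \<boxtimes> H) (g, s) (a, b) (c, d) \<longleftrightarrow>
      max (hop_dist G g a) (hop_dist H s b) \<noteq> max (hop_dist G g c) (hop_dist H s d)"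
    if "g \<in> pverts G" for g
    using that s V by (simp add: GH.distinguishes_iff_hop_dist pverts_strong_product
        hop_dist_strong_product)
  show ?thesis
  \<comment> \<open>The first coordinate is taken from whichever vertex is nearer to
    \<open>s\<close> in \<open>H\<close>. Its own first distance is then 0, and the larger distance
    in \<open>H\<close> is at least 1, so it absorbs the first distance to the other vertex, which
    is at most 1.\<close>
  proof (cases "hop_dist H s b < hop_dist H s d")
    case True
    then have "distinguishes (G \<boxtimes> H) (a, s) (a, b) (c, d)"
      using V le1 by (simp add: iff G.hop_dist_self)
    with V show ?thesis by blast
  next
    case False
    then have "distinguishes (G \<boxtimes> H) (c, s) (a, b) (c, d)"
      using V le1 ne by (simp add: iff G.hop_dist_self)
    with V show ?thesis by blast
  qed
qed

end

text \<open>Exchanging the factors yields facts about the first coordinate from those about the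
  second.\<close>

lemma connected_pair_graph_product_swap:
  "connected_pair_graph_product G H \<Longrightarrow> connected_pair_graph_product H G"
  by (simp add: connected_pair_graph_product_def)

context connected_pair_graph_product
begin

lemma distinguishes_strong_product_swap:
  assumes "a \<in> pverts G" "b \<in> pverts H" "c \<in> pverts G" "d \<in> pverts H"
    and "g \<in> pverts G" "h \<in> pverts H"
  shows "distinguishes (H \<boxtimes> G) (h, g) (b, a) (d, c) \<longleftrightarrow>
    distinguishes (G \<boxtimes> H) (g, h) (a, b) (c, d)"
proof -
  interpret swap: connected_pair_graph_product H G
    by (rule connected_pair_graph_product_swap) unfold_locales
  show ?thesis
    using assms by (simp add: GH.distinguishes_iff_hop_dist swap.GH.distinguishes_iff_hop_dist
        pverts_strong_product swap.pverts_strong_product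
        hop_dist_strong_product swap.hop_dist_strong_product max.commute)
qed

lemma distinguishes_strong_product_fst:
  assumes "s \<in> pverts G" "distinguishes G s a c" "(a, c) \<in> parcs G"
    and "(b, d) \<in> lazy_arcs H"
  shows "\<exists>h\<in>pverts H. distinguishes (G \<boxtimes> H) (s, h) (a, b) (c, d)"
proof -
  interpret swap: connected_pair_graph_product H G
    by (rule connected_pair_graph_product_swap) unfold_locales
  have V: "a \<in> pverts G" "c \<in> pverts G" "b \<in> pverts H" "d \<in> pverts H"
    using assms by (auto simp: lazy_arcs_def dest: G.wellformed' H.wellformed')
  show ?thesis
    using swap.distinguishes_strong_product_snd[OF assms] V assms(1)
    by (simp add: distinguishes_strong_product_swap)
qed

text \<open>Every product arc moves some coordinate along an arc of its factor, and a landmark of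
  that factor works. The other coordinate of the landmark depends on the arc, so the full vertex set
  is provided for it.\<close>

lemma local_metric_generator_strong_product:
  assumes S: "local_metric_generator G S" and T: "local_metric_generator H T"
  shows "local_metric_generator (G \<boxtimes> H) (pverts G \<times> T \<union> S \<times> pverts H)"
    (is "local_metric_generator _ ?R")
proof -
  have sub: "S \<subseteq> pverts G" "T \<subseteq> pverts H"
    using S T by (simp_all add: local_metric_generator_def)
  have "\<exists>r\<in>?R. distinguishes (G \<boxtimes> H) r (a, b) (c, d)"
    if arc: "((a, b), (c, d)) \<in> parcs (G \<boxtimes> H)" for a b c d
  proof -
    have lazy: "(a, c) \<in> lazy_arcs G" "(b, d) \<in> lazy_arcs H"
      using arc lazy_arcs_strong_product[of a b c d G H] by (auto simp: lazy_arcs_def)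
    consider "(b, d) \<in> parcs H" | "(a, c) \<in> parcs G"
      using arc by (auto simp: strong_product_def)
    then show ?thesis
    proof cases
      case 1
      then obtain t where "t \<in> T" "distinguishes H t b d"
        using T by (auto simp: local_metric_generator_def)
      then show ?thesis
        using distinguishes_strong_product_snd[of t b d a c] 1 lazy sub by blast
    next
      case 2
      then obtain s where "s \<in> S" "distinguishes G s a c"
        using S by (auto simp: local_metric_generator_def)
      then show ?thesis
        using distinguishes_strong_product_fst[of s a c b d] 2 lazy sub by blast
    qed
  qed
  then show ?thesis
    using sub by (auto simp: local_metric_generator_def pverts_strong_product)
qed

lemma local_metric_dim_strong_product_le:
  "int (local_metric_dim (G \<boxtimes> H)) \<le>
    int (card (pverts G)) * int (local_metric_dim H)
    + int (card (pverts H)) * int (local_metric_dim G)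
    - int (local_metric_dim G) * int (local_metric_dim H)"
proof -
  obtain S T where S: "local_metric_generator G S" "card S = local_metric_dim G"
    and T: "local_metric_generator H T" "card T = local_metric_dim H"
    using G.minimum_local_metric_generator_exists H.minimum_local_metric_generator_exists
    by blast
  have sub: "S \<subseteq> pverts G" "T \<subseteq> pverts H"
    using S T by (simp_all add: local_metric_generator_def)
  have fin: "finite (pverts G)" "finite (pverts H)" "finite S" "finite T"
    using sub G.pair_finite_verts H.pair_finite_verts finite_subset by blast+
  \<comment> \<open>The overlap of the two blocks is the term subtracted in the bound; the count
    stays additive in \<open>nat\<close> before passing to \<open>int\<close>, where subtraction is
    not truncated.\<close>
  have "(pverts G \<times> T) \<inter> (S \<times> pverts H) = S \<times> T"
    using sub by blast
  then have "card (pverts G \<times> T \<union> S \<times> pverts H) + card S * card T =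
      card (pverts G) * card T + card S * card (pverts H)"
    using card_Un_Int[of "pverts G \<times> T" "S \<times> pverts H"] fin
    by (simp add: card_cartesian_product)
  moreover have "local_metric_dim (G \<boxtimes> H) \<le> card (pverts G \<times> T \<union> S \<times> pverts H)"
    using local_metric_generator_strong_product[OF S(1) T(1)] by (rule local_metric_dim_le)
  ultimately have "local_metric_dim (G \<boxtimes> H) + card S * card T \<le>
      card (pverts G) * card T + card (pverts H) * card S"
    by (simp add: mult.commute)
  then have "int (local_metric_dim (G \<boxtimes> H) + card S * card T) \<le>
      int (card (pverts G) * card T + card (pverts H) * card S)"
    by (simp only: of_nat_le_iff)
  then show ?thesis by (simp add: S(2) T(2))
qed

section \<open>Lower bound: four-cliques in the product\<close>

lemma local_metric_dim_strong_product_ge_3: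
  assumes "card (pverts G) \<ge> 2" "card (pverts H) \<ge> 2"
  shows "3 \<le> local_metric_dim (G \<boxtimes> H)"
proof -
  obtain R where R: "local_metric_generator (G \<boxtimes> H) R" "card R = local_metric_dim (G \<boxtimes> H)"
    using GH.minimum_local_metric_generator_exists by blast
  have "3 \<le> card R"
  proof (rule GH.card_local_metric_generator_ge_3[OF R(1)])
    show "pverts (G \<boxtimes> H) \<noteq> {}" using assms by (auto simp: pverts_strong_product)
  next
    fix s assume "s \<in> pverts (G \<boxtimes> H)"
    then obtain a b where s: "s = (a, b)" "a \<in> pverts G" "b \<in> pverts H"
      by (auto simp: pverts_strong_product)
    obtain c d where cd: "(a, c) \<in> parcs G" "(b, d) \<in> parcs H"
      using G.pverts_adjacent_exists H.pverts_adjacent_exists s assms by blast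
    then have "c \<in> pverts G" "d \<in> pverts H" "(c, a) \<in> parcs G"
      by (auto dest: G.wellformed' H.wellformed' G.arcs_symmetric)
    \<comment> \<open>An arc of \<open>G\<close> and an arc of \<open>H\<close> span four vertices
      of the product: sides move one coordinate, diagonals move both, so all pairs are
      adjacent.\<close>
    with s cd have "{(s, (a, d)), (s, (c, d)), (s, (c, b)), ((a, d), (c, d)),
        ((c, d), (c, b)), ((a, d), (c, b))} \<subseteq> parcs (G \<boxtimes> H)"
      by (auto simp: strong_product_def dest: H.arcs_symmetric)
    then show "\<exists>x y z. {(s, x), (s, y), (s, z), (x, y), (y, z), (x, z)} \<subseteq> parcs (G \<boxtimes> H)"
      by blast
  qed
  with R(2) show ?thesis by simp
qed

end

theorem theorem4:
  fixes G :: "'a pair_pre_digraph" and H :: "'b pair_pre_digraph" and n\<^sub>1 n\<^sub>2 :: nat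
  assumes "pair_graph G" and "Digraph_Component.connected (with_proj G)"
    and "pair_graph H" and "Digraph_Component.connected (with_proj H)"
    and "card (pverts G) = n\<^sub>1" and "n\<^sub>1 \<ge> 2"
    and "card (pverts H) = n\<^sub>2" and "n\<^sub>2 \<ge> 2"
  shows "3 \<le> local_metric_dim (G \<boxtimes> H) \<and>
    int (local_metric_dim (G \<boxtimes> H)) \<le>
      int n\<^sub>1 * int (local_metric_dim H) + int n\<^sub>2 * int (local_metric_dim G)
      - int (local_metric_dim G) * int (local_metric_dim H)"
proof -
  interpret connected_pair_graph_product G H
    unfolding connected_pair_graph_product_def
    using assms by (blast intro: connected_pair_graphI)
  show ?thesis
    using local_metric_dim_strong_product_le local_metric_dim_strong_product_ge_3 assms by simp
qed

end
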